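(* Let $G$ be a finite simple connected graph. Then $\beth^{2}(K^{h(G)})\le \beth^{2}(G)$; that is, $$\binom{h(G)}{3}-\binom{h(G)}{2}+\binom{h(G)}{1}\le \beth^{2}(G).$$
   Context: All graphs are finite and simple. $K^{t}$ is the complete graph on $t$ vertices. The Hadwiger number $h(G)$ is the maximum $t$ such that $K^{t}$ is a minor of $G$. $C(G)$ denotes the set of all induced cycles in $G$ (induced subgraphs of $G$ that are cycles, of length at least 3). The second graph characteristic is $\beth^{2}(G)=|C(G)|-|E(G)|+|V(G)|$. *)

theory Defs
  imports "Graph_Theory.Graph_Theory"
begin

text \<open>
  Finite simple graphs are the symmetric loop-free pair digraphs \<^term>\<open>pair_graph G\<close>: an
  undirected edge \<open>uv\<close> is represented by the two arcs \<open>(u, v)\<close> and \<open>(v, u)\<close>.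
\<close>

definition edges :: "'a pair_pre_digraph \<Rightarrow> 'a set set" where
  "edges G = {{u, v} | u v. (u, v) \<in> parcs G}"

definition complete_graph :: "nat \<Rightarrow> nat pair_pre_digraph" where
  "complete_graph t =
     \<lparr> pverts = {..<t}, parcs = {(u, v). u < t \<and> v < t \<and> u \<noteq> v} \<rparr>"

text \<open>
  The predicate \<open>cycle\<close> of the library counts the closed walk \<open>u, v, u\<close> along a single undirected
  edge as a cycle, so undirected cycles, as graphs, are defined separately.
\<close>

definition cycle_graph :: "'a pair_pre_digraph \<Rightarrow> bool" where
  "cycle_graph C \<longleftrightarrow>
     (\<exists>vs. distinct vs \<and> 3 \<le> length vs \<and> pverts C = set vs \<and>
       parcs C = (\<Union>i<length vs.
         {(vs ! i, vs ! (Suc i mod length vs)), (vs ! (Suc i mod length vs), vs ! i)}))"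

definition induced_cycles :: "'a pair_pre_digraph \<Rightarrow> 'a pair_pre_digraph set" where
  "induced_cycles G = {C. induced_subgraph (with_proj C) (with_proj G) \<and> cycle_graph C}"

definition beth2 :: "'a pair_pre_digraph \<Rightarrow> int" where
  "beth2 G = int (card (induced_cycles G)) - int (card (edges G)) + int (card (pverts G))"

text \<open>
  \<open>B x\<close> is the branch set of the vertex \<open>x\<close> of \<open>H\<close>. Branch sets are nonempty because
  \<^const>\<open>Digraph_Component.connected\<close> excludes the null graph.
\<close>

definition is_minor :: "'b pair_pre_digraph \<Rightarrow> 'a pair_pre_digraph \<Rightarrow> bool" where
  "is_minor H G \<longleftrightarrow>
     (\<exists>B :: 'b \<Rightarrow> 'a set.
       (\<forall>x \<in> pverts H. B x \<subseteq> pverts G \<and>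
          Digraph_Component.connected (with_proj G \<restriction> B x)) \<and>
       (\<forall>x \<in> pverts H. \<forall>y \<in> pverts H. x \<noteq> y \<longrightarrow> B x \<inter> B y = {}) \<and>
       (\<forall>(x, y) \<in> parcs H. \<exists>u \<in> B x. \<exists>v \<in> B y. (u, v) \<in> parcs G))"

definition hadwiger :: "'a pair_pre_digraph \<Rightarrow> nat" where
  "hadwiger G = Max {t. is_minor (complete_graph t) G}"

lemma complete_graph_complete: "complete_digraph t (with_proj (complete_graph t))"
  unfolding complete_digraph_pair_def by (auto simp: complete_graph_def)

lemma complete_minor_le_card:
  assumes "pair_graph G" and "is_minor (complete_graph t) G"
  shows "t \<le> card (pverts G)"
proof -
  interpret pair_graph G by fact
  from assms(2) obtain B :: "nat \<Rightarrow> 'a set" where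
    B: "\<forall>x\<in>{..<t}. B x \<subseteq> pverts G \<and> Digraph_Component.connected (with_proj G \<restriction> B x)"
    and B': "\<forall>x\<in>{..<t}. \<forall>y\<in>{..<t}. x \<noteq> y \<longrightarrow> B x \<inter> B y = {}"
    unfolding is_minor_def complete_graph_def pair_pre_digraph.simps by blast
  have sub: "B x \<subseteq> pverts G"
    and con: "Digraph_Component.connected (with_proj G \<restriction> B x)" if "x < t" for x
    using B that by auto
  have dis: "B x \<inter> B y = {}" if "x < t" "y < t" "x \<noteq> y" for x y
    using B' that by auto
  have ne: "B x \<noteq> {}" if "x < t" for x
    using con[OF that]
    by (auto simp: Digraph_Component.connected_def strongly_connected_def mk_symmetric_def)
  define f where "f x = (SOME v. v \<in> B x)" for x
  have f: "f x \<in> B x" if "x < t" for x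
    unfolding f_def using ne[OF that] by (simp add: some_in_eq)
  have "inj_on f {..<t}"
  proof (rule inj_onI)
    fix x y assume "x \<in> {..<t}" "y \<in> {..<t}" "f x = f y"
    then show "x = y" using f[of x] f[of y] dis[of x y] by auto
  qed
  moreover have "f ` {..<t} \<subseteq> pverts G" using f sub by blast
  ultimately have "card {..<t} \<le> card (pverts G)"
    using pair_finite_verts by (intro card_inj_on_le)
  then show ?thesis by simp
qed

text \<open>The maximum in the definition of \<^const>\<open>hadwiger\<close> is attained.\<close>

lemma
  assumes "pair_graph G"
  shows finite_complete_minors: "finite {t. is_minor (complete_graph t) G}"
    and is_minor_complete_hadwiger: "is_minor (complete_graph (hadwiger G)) G"
proof -
  show fin: "finite {t. is_minor (complete_graph t) G}"
    by (rule finite_subset[of _ "{..card (pverts G)}"])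
       (auto dest: complete_minor_le_card[OF assms])
  have "is_minor (complete_graph 0) G"
    unfolding is_minor_def by (simp add: complete_graph_def)
  then have "{t. is_minor (complete_graph t) G} \<noteq> {}" by blast
  from Max_in[OF fin this] show "is_minor (complete_graph (hadwiger G)) G"
    unfolding hadwiger_def by simp
qed

end

theory Submission
  imports Defs "HOL-Number_Theory.Cong"
begin

text \<open>
  Contracting an edge \<open>uv\<close> never increases \<^const>\<open>beth2\<close>. It loses one vertex and, if \<open>u\<close> and \<open>v\<close> have
  \<open>k\<close> common neighbours, \<open>k + 1\<close> edges; so at least \<open>k\<close> induced cycles have to disappear. Every
  induced cycle through the contracted vertex lifts to one of the original graph, by replacing that
  vertex by \<open>u\<close>, by \<open>v\<close>, or by the edge \<open>uv\<close>. Distinct cycles have distinct lifts, and no lift is one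
  of the \<open>k\<close> triangles on \<open>uv\<close>.

  In a connected graph, contraction alone turns a model of a complete minor into the complete graph:
  vertices outside all branch sets are absorbed by contracting an edge to a branch set. Hence no
  deletions, which may increase \<^const>\<open>beth2\<close>, are needed.
\<close>

section \<open>Chordless cycles as vertex sets\<close>

text \<open>An induced cycle is determined by its vertex set \<open>S\<close>, so cycles of a graph
  and of its contraction can be compared as sets of vertices under two different relations.\<close>

definition chordless_cycle :: "'a rel \<Rightarrow> 'a set \<Rightarrow> bool" where
  "chordless_cycle E S \<longleftrightarrow>
     (\<exists>vs. distinct vs \<and> 3 \<le> length vs \<and> set vs = S \<and>
       (\<forall>i<length vs. \<forall>j<length vs. (vs ! i, vs ! j) \<in> E \<longleftrightarrow>
         j = Suc i mod length vs \<or> i = Suc j mod length vs))"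

lemma nth_eq_hd_iff: "distinct ws \<Longrightarrow> i < length ws \<Longrightarrow> ws ! i = hd ws \<longleftrightarrow> i = 0"
  by (cases ws) (auto simp: nth_Cons')

lemma nth_eq_last_iff:
  assumes "distinct ws" "i < length ws"
  shows "ws ! i = last ws \<longleftrightarrow> Suc i = length ws"
proof -
  have "last ws = ws ! (length ws - 1)" using assms(2) by (intro last_conv_nth) auto
  then have "ws ! i = last ws \<longleftrightarrow> i = length ws - 1"
    using assms by (simp add: nth_eq_iff_index_eq)
  then show ?thesis using assms(2) by auto
qed

text \<open>This is what remains of a chordless cycle when one vertex is taken out, and the part of
  a cycle that a contraction leaves unchanged.\<close>

definition induced_path :: "'a rel \<Rightarrow> 'a list \<Rightarrow> bool" where
  "induced_path E ws \<longleftrightarrow> distinct ws \<and>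
     (\<forall>i<length ws. \<forall>j<length ws. (ws ! i, ws ! j) \<in> E \<longleftrightarrow> j = Suc i \<or> i = Suc j)"

lemma chordless_cycle_cong:
  assumes "\<And>x y. x \<in> S \<Longrightarrow> y \<in> S \<Longrightarrow> (x, y) \<in> E \<longleftrightarrow> (x, y) \<in> F"
  shows "chordless_cycle E S \<longleftrightarrow> chordless_cycle F S"
proof -
  have "(vs ! i, vs ! j) \<in> E \<longleftrightarrow> (vs ! i, vs ! j) \<in> F"
    if "set vs = S" "i < length vs" "j < length vs" for vs i j
    using that assms by (metis nth_mem)
  then show ?thesis unfolding chordless_cycle_def by (smt (verit))
qed

text \<open>Adding \<open>k\<close> is injective modulo \<open>n\<close> and commutes with the
  cyclic successor; hence cyclic adjacency is invariant under rotating the list.\<close>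

lemma mod_Suc_shift_iff:
  fixes i j k n :: nat
  assumes "i < n" "j < n"
  shows "(j + k) mod n = Suc ((i + k) mod n) mod n \<longleftrightarrow> j = Suc i mod n"
proof -
  have "Suc ((i + k) mod n) mod n = (Suc i mod n + k) mod n"
    by (simp add: mod_simps)
  moreover have "(j + k) mod n = (Suc i mod n + k) mod n \<longleftrightarrow> j = Suc i mod n"
    using assms cong_add_rcancel_nat[of j k "Suc i mod n" n] by (simp add: cong_def)
  ultimately show ?thesis by simp
qed

lemma Suc_mod_Suc: "i \<le> n \<Longrightarrow> Suc i mod Suc n = (if i = n then 0 else Suc i)"
  by simp

lemma chordless_cycle_rotate:
  assumes "chordless_cycle E S" "u \<in> S"
  obtains ws where "distinct (u # ws)" "2 \<le> length ws" "set (u # ws) = S"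
    "\<And>i j. i \<le> length ws \<Longrightarrow> j \<le> length ws \<Longrightarrow> ((u # ws) ! i, (u # ws) ! j) \<in> E \<longleftrightarrow>
         j = Suc i mod Suc (length ws) \<or> i = Suc j mod Suc (length ws)"
proof -
  obtain vs where vs: "distinct vs" "3 \<le> length vs" "set vs = S"
    and adj: "\<And>i j. i < length vs \<Longrightarrow> j < length vs \<Longrightarrow> (vs ! i, vs ! j) \<in> E \<longleftrightarrow>
         j = Suc i mod length vs \<or> i = Suc j mod length vs"
    using assms(1) unfolding chordless_cycle_def by auto
  obtain k where k: "k < length vs" "vs ! k = u"
    using assms(2) vs(3) by (metis in_set_conv_nth)
  define xs where "xs = rotate k vs"
  have len: "length xs = length vs" by (simp add: xs_def)
  have "0 < length vs" using vs(2) by linarith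
  then have "xs ! 0 = u" using k nth_rotate[of 0 vs k] by (simp add: xs_def)
  then obtain ws where ws: "xs = u # ws" using len vs(2) by (cases xs) auto
  have "(xs ! i, xs ! j) \<in> E \<longleftrightarrow> j = Suc i mod length xs \<or> i = Suc j mod length xs"
    if "i < length xs" "j < length xs" for i j
  proof -
    have "(xs ! i, xs ! j) \<in> E \<longleftrightarrow>
        (vs ! ((i + k) mod length vs), vs ! ((j + k) mod length vs)) \<in> E"
      using that len by (simp add: xs_def nth_rotate add.commute)
    also have "\<dots> \<longleftrightarrow> j = Suc i mod length vs \<or> i = Suc j mod length vs"
      using that len \<open>0 < length vs\<close> by (simp add: adj mod_Suc_shift_iff)
    finally show ?thesis using len by simp
  qed
  then show thesis
    using that[of ws] vs len ws unfolding xs_def[symmetric]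
    by (metis One_nat_def Suc_le_mono distinct_rotate length_Cons less_Suc_eq_le numeral_2_eq_2
        numeral_3_eq_3 set_rotate xs_def)
qed

text \<open>Opening a cycle at \<open>u\<close> disposes of the modular indices once and for all:
  later arguments see only a path and its two ends.\<close>

lemma chordless_cycleE:
  assumes "chordless_cycle E S" "u \<in> S"
  obtains ws where "induced_path E ws" "2 \<le> length ws" "u \<notin> set ws" "S = insert u (set ws)"
    "\<And>w. w \<in> set ws \<Longrightarrow> (u, w) \<in> E \<longleftrightarrow> w = hd ws \<or> w = last ws"
proof -
  obtain ws where ws: "distinct (u # ws)" "2 \<le> length ws" "set (u # ws) = S"
    and adj: "\<And>i j. i \<le> length ws \<Longrightarrow> j \<le> length ws \<Longrightarrow> ((u # ws) ! i, (u # ws) ! j) \<in> E \<longleftrightarrow>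
         j = Suc i mod Suc (length ws) \<or> i = Suc j mod Suc (length ws)"
    by (rule chordless_cycle_rotate[OF assms]) (rule that, assumption+)
  have "induced_path E ws"
    unfolding induced_path_def
  proof (intro conjI allI impI)
    fix i j assume ij: "i < length ws" "j < length ws"
    then have "(ws ! i, ws ! j) \<in> E \<longleftrightarrow>
        Suc j = Suc (Suc i) mod Suc (length ws) \<or> Suc i = Suc (Suc j) mod Suc (length ws)"
      using adj[of "Suc i" "Suc j"] by (simp only: Suc_le_eq nth_Cons_Suc)
    \<comment> \<open>The wrap-around value \<open>0\<close> is the position of \<open>u\<close>, so
      between positions of \<open>ws\<close> cyclic succession is plain succession.\<close>
    moreover have "Suc l = Suc (Suc k) mod Suc (length ws) \<longleftrightarrow> l = Suc k"
      if "k < length ws" "l < length ws" for k l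
      using that Suc_mod_Suc[of "Suc k" "length ws"] by (cases "Suc k = length ws") auto
    ultimately show "(ws ! i, ws ! j) \<in> E \<longleftrightarrow> j = Suc i \<or> i = Suc j"
      using ij by blast
  qed (use ws in simp)
  moreover have "(u, w) \<in> E \<longleftrightarrow> w = hd ws \<or> w = last ws" if w: "w \<in> set ws" for w
  proof -
    obtain i where i: "i < length ws" "w = ws ! i" using w by (auto simp: in_set_conv_nth)
    have "(u, w) \<in> E \<longleftrightarrow> i = 0 \<or> Suc i = length ws"
      using adj[of 0 "Suc i"] i ws(2) by (auto simp: Suc_mod_Suc)
    then show ?thesis using i ws(1) by (simp add: nth_eq_hd_iff nth_eq_last_iff)
  qed
  ultimately show thesis using that ws by auto
qed

text \<open>The converse of \<open>chordless_cycleE\<close>, used to close an induced path into a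
  cycle when lifts are built.\<close>

lemma chordless_cycleI:
  assumes "sym E" "(u, u) \<notin> E" "induced_path E ws" "2 \<le> length ws" "u \<notin> set ws"
    and adj: "\<And>w. w \<in> set ws \<Longrightarrow> (u, w) \<in> E \<longleftrightarrow> w = hd ws \<or> w = last ws"
  shows "chordless_cycle E (insert u (set ws))"
  unfolding chordless_cycle_def
proof (intro exI[of _ "u # ws"] conjI allI impI)
  have dist: "distinct ws" using assms(3) by (simp add: induced_path_def)
  then show "distinct (u # ws)" using assms(5) by simp
  show "3 \<le> length (u # ws)" using assms(4) by simp
  have u: "(u, ws ! i) \<in> E \<longleftrightarrow> i = 0 \<or> Suc i = length ws" if "i < length ws" for i
    using adj[of "ws ! i"] that dist by (simp add: nth_eq_hd_iff nth_eq_last_iff)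
  have u': "(ws ! i, u) \<in> E \<longleftrightarrow> i = 0 \<or> Suc i = length ws" if "i < length ws" for i
    using u[OF that] assms(1) by (metis symD)
  have ws: "(ws ! i, ws ! j) \<in> E \<longleftrightarrow> j = Suc i \<or> i = Suc j"
    if "i < length ws" "j < length ws" for i j
    using that assms(3) by (simp add: induced_path_def)
  fix i j assume "i < length (u # ws)" "j < length (u # ws)"
  then show "((u # ws) ! i, (u # ws) ! j) \<in> E \<longleftrightarrow>
      j = Suc i mod length (u # ws) \<or> i = Suc j mod length (u # ws)"
    using assms(2,4) u u' ws by (cases i; cases j) (auto simp: Suc_mod_Suc)
qed simp

text \<open>Serves the lift through the edge \<open>uv\<close>: one of its ends prolongs the path
  before the other closes the cycle.\<close>

lemma induced_path_snoc:
  assumes "sym E" "(v, v) \<notin> E" "induced_path E ws" "ws \<noteq> []" "v \<notin> set ws"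
    and adj: "\<And>w. w \<in> set ws \<Longrightarrow> (v, w) \<in> E \<longleftrightarrow> w = last ws"
  shows "induced_path E (ws @ [v])"
proof -
  have dist: "distinct ws" using assms(3) by (simp add: induced_path_def)
  have v: "(v, ws ! i) \<in> E \<longleftrightarrow> Suc i = length ws" if "i < length ws" for i
    using adj[of "ws ! i"] that dist by (simp add: nth_eq_last_iff)
  have v': "(ws ! i, v) \<in> E \<longleftrightarrow> Suc i = length ws" if "i < length ws" for i
    using v[OF that] assms(1) by (metis symD)
  show ?thesis
    using assms(2,3,5) v v' unfolding induced_path_def
    by (auto simp: nth_append less_Suc_eq)
qed

lemma induced_path_cong:
  assumes "\<And>x y. x \<in> set ws \<Longrightarrow> y \<in> set ws \<Longrightarrow> (x, y) \<in> E \<longleftrightarrow> (x, y) \<in> F"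
  shows "induced_path E ws \<longleftrightarrow> induced_path F ws"
  using assms unfolding induced_path_def by auto

section \<open>Induced cycles counted by their vertex sets\<close>

text \<open>Distinctness of the list turns membership in the union of arcs into a condition on
  indices. The inclusion in \<open>pverts C \<times> pverts C\<close> is stated separately because
  \<open>chordless_cycle\<close> only inspects arcs between vertices of its set.\<close>

lemma cycle_graph_iff:
  "cycle_graph C \<longleftrightarrow> parcs C \<subseteq> pverts C \<times> pverts C \<and> chordless_cycle (parcs C) (pverts C)"
proof -
  have "(parcs C = (\<Union>i<length vs.
         {(vs ! i, vs ! (Suc i mod length vs)), (vs ! (Suc i mod length vs), vs ! i)})) \<longleftrightarrow>
      parcs C \<subseteq> pverts C \<times> pverts C \<and>
      (\<forall>i<length vs. \<forall>j<length vs. (vs ! i, vs ! j) \<in> parcs C \<longleftrightarrow>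
         j = Suc i mod length vs \<or> i = Suc j mod length vs)" (is "_ = ?U \<longleftrightarrow> ?sub \<and> ?R")
    if vs: "distinct vs" "3 \<le> length vs" "pverts C = set vs" for vs
  proof -
    have U: "(vs ! i, vs ! j) \<in> ?U \<longleftrightarrow> j = Suc i mod length vs \<or> i = Suc j mod length vs"
      if "i < length vs" "j < length vs" for i j
    proof -
      have "Suc k mod length vs < length vs" for k
        using that by (intro mod_less_divisor) auto
      then show ?thesis using that vs(1) by (auto simp: nth_eq_iff_index_eq)
    qed
    have Usub: "?U \<subseteq> pverts C \<times> pverts C"
      using vs by (auto intro!: nth_mem mod_less_divisor)
    show ?thesis
    proof
      assume "parcs C = ?U"
      then show "?sub \<and> ?R" using U Usub by simp
    next
      assume R: "?sub \<and> ?R"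
      have "(x, y) \<in> parcs C \<longleftrightarrow> (x, y) \<in> ?U" if xy: "x \<in> set vs" "y \<in> set vs" for x y
      proof -
        obtain i j where "i < length vs" "x = vs ! i" "j < length vs" "y = vs ! j"
          using xy by (metis in_set_conv_nth)
        then show ?thesis using U[of i j] R by simp
      qed
      then show "parcs C = ?U" using R Usub vs(3) by (auto simp del: UN_iff)
    qed
  qed
  note * = this
  show ?thesis
  proof
    assume "cycle_graph C"
    then obtain vs where "distinct vs" "3 \<le> length vs" "pverts C = set vs" "parcs C = (\<Union>i<length vs.
        {(vs ! i, vs ! (Suc i mod length vs)), (vs ! (Suc i mod length vs), vs ! i)})"
      unfolding cycle_graph_def by blast
    with *[of vs] show "parcs C \<subseteq> pverts C \<times> pverts C \<and> chordless_cycle (parcs C) (pverts C)"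
      unfolding chordless_cycle_def by blast
  next
    assume C: "parcs C \<subseteq> pverts C \<times> pverts C \<and> chordless_cycle (parcs C) (pverts C)"
    then obtain vs where vs: "distinct vs" "3 \<le> length vs" "set vs = pverts C"
      and adj: "\<forall>i<length vs. \<forall>j<length vs. (vs ! i, vs ! j) \<in> parcs C \<longleftrightarrow>
         j = Suc i mod length vs \<or> i = Suc j mod length vs"
      unfolding chordless_cycle_def by blast
    then show "cycle_graph C"
      unfolding cycle_graph_def using *[OF vs(1,2) vs(3)[symmetric], THEN iffD2, OF conjI, OF _ adj] C vs
      by (intro exI[of _ vs] conjI) simp_all
  qed
qed

text \<open>An induced subgraph is recovered from its vertex set by restricting the arcs, so
  \<open>pverts\<close> is a bijection.\<close>

lemma card_induced_cycles:
  assumes "pair_wf_digraph G"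
  shows "card (induced_cycles G) = card {S. S \<subseteq> pverts G \<and> chordless_cycle (parcs G) S}"
proof (rule bij_betw_same_card)
  interpret pair_wf_digraph G by fact
  let ?r = "\<lambda>S. \<lparr> pverts = S, parcs = parcs G \<inter> S \<times> S \<rparr>"
  have ind: "induced_subgraph (with_proj C) (with_proj G) \<longleftrightarrow>
      pverts C \<subseteq> pverts G \<and> parcs C = parcs G \<inter> pverts C \<times> pverts C" for C
  proof
    assume "induced_subgraph (with_proj C) (with_proj G)"
    then show "pverts C \<subseteq> pverts G \<and> parcs C = parcs G \<inter> pverts C \<times> pverts C"
      unfolding induced_subgraph_def subgraph_def by auto
  next
    assume C: "pverts C \<subseteq> pverts G \<and> parcs C = parcs G \<inter> pverts C \<times> pverts C"
    then have "wf_digraph (with_proj C)" by unfold_locales auto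
    then show "induced_subgraph (with_proj C) (with_proj G)"
      using C wf_digraph_axioms
      unfolding induced_subgraph_def subgraph_def compatible_def by auto
  qed
  have cyc: "chordless_cycle (parcs G \<inter> S \<times> S) S \<longleftrightarrow> chordless_cycle (parcs G) S" for S
    by (rule chordless_cycle_cong) auto
  show "bij_betw pverts (induced_cycles G) {S. S \<subseteq> pverts G \<and> chordless_cycle (parcs G) S}"
    by (rule bij_betw_byWitness[where f' = ?r])
      (auto simp: induced_cycles_def ind cycle_graph_iff cyc)
qed

section \<open>Complete graphs\<close>

text \<open>Edges are the 2-subsets of the vertices, and induced cycles the 3-subsets, since a
  longer cycle would have a chord.\<close>

lemma beth2_complete:
  assumes "pair_graph G"
    and complete: "\<And>x y. x \<in> pverts G \<Longrightarrow> y \<in> pverts G \<Longrightarrow> x \<noteq> y \<Longrightarrow> (x, y) \<in> parcs G"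
  shows "beth2 G = int (card (pverts G) choose 3) - int (card (pverts G) choose 2)
    + int (card (pverts G))"
proof -
  interpret pair_graph G by fact
  have loop: "(x, x) \<notin> parcs G" for x using pair_no_loops by fastforce
  have adj: "(x, y) \<in> parcs G \<longleftrightarrow> x \<noteq> y" if "x \<in> pverts G" "y \<in> pverts G" for x y
    using complete[OF that] loop by auto
  have "edges G = {T. T \<subseteq> pverts G \<and> card T = 2}"
  proof (intro set_eqI iffI)
    fix T assume "T \<in> edges G"
    then obtain x y where "T = {x, y}" "(x, y) \<in> parcs G" by (auto simp: edges_def)
    then show "T \<in> {T. T \<subseteq> pverts G \<and> card T = 2}"
      using adj[of x y] in_arcsD1[of x y] in_arcsD2[of x y] by simp
  next
    fix T assume "T \<in> {T. T \<subseteq> pverts G \<and> card T = 2}"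
    then obtain x y where "T = {x, y}" "x \<noteq> y" "x \<in> pverts G" "y \<in> pverts G"
      by (auto simp: card_2_iff)
    then show "T \<in> edges G" using adj[of x y] by (auto simp: edges_def)
  qed
  then have E: "card (edges G) = card (pverts G) choose 2"
    by (simp add: n_subsets pair_finite_verts)
  have "chordless_cycle (parcs G) S \<longleftrightarrow> card S = 3" if S: "S \<subseteq> pverts G" for S
  proof
    assume "chordless_cycle (parcs G) S"
    then obtain vs where vs: "distinct vs" "3 \<le> length vs" "set vs = S"
      and vadj: "\<And>i j. i < length vs \<Longrightarrow> j < length vs \<Longrightarrow> (vs ! i, vs ! j) \<in> parcs G \<longleftrightarrow>
         j = Suc i mod length vs \<or> i = Suc j mod length vs"
      unfolding chordless_cycle_def by auto
    have "length vs = 3"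
    proof (rule ccontr)
      assume "length vs \<noteq> 3"
      then have n: "4 \<le> length vs" using vs(2) by simp
      then have "0 < length vs" "2 < length vs" by linarith+
      then have "vs ! 0 \<in> set vs" "vs ! 2 \<in> set vs" by (simp_all only: nth_mem)
      then have "vs ! 0 \<in> pverts G" "vs ! 2 \<in> pverts G" using S vs(3) by blast+
      \<comment> \<open>Positions \<open>0\<close> and \<open>2\<close> are not cyclically
        consecutive once the length is at least 4, so this arc is a chord.\<close>
      moreover have "vs ! 0 \<noteq> vs ! 2" using n vs(1) by (subst nth_eq_iff_index_eq) auto
      ultimately have "(vs ! 0, vs ! 2) \<in> parcs G" by (simp add: adj)
      then have "2 = Suc 0 mod length vs \<or> 0 = Suc 2 mod length vs"
        using vadj[of 0 2] \<open>0 < length vs\<close> \<open>2 < length vs\<close> by blast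
      then show False using n by (simp add: mod_Suc split: if_splits)
    qed
    then show "card S = 3" using vs distinct_card by metis
  next
    assume "card S = 3"
    then obtain a b c where abc: "S = {a, b, c}" "a \<noteq> b" "a \<noteq> c" "b \<noteq> c"
      by (auto simp: card_3_iff)
    then have "chordless_cycle (parcs G) (insert a (set [b, c]))"
      using S sym_arcs by (intro chordless_cycleI)
        (auto simp: adj induced_path_def less_Suc_eq loop symmetric_def)
    then show "chordless_cycle (parcs G) S" using abc by simp
  qed
  then have "{S. S \<subseteq> pverts G \<and> chordless_cycle (parcs G) S} = {S. S \<subseteq> pverts G \<and> card S = 3}"
    by blast
  then have "card (induced_cycles G) = card (pverts G) choose 3"
    by (simp add: card_induced_cycles pair_wf_digraph_axioms n_subsets pair_finite_verts)
  then show ?thesis using E by (simp add: beth2_def)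
qed

section \<open>Connectivity by cuts\<close>

text \<open>Connectivity in terms of cuts instead of walks: it passes easily to contractions and
  directly yields the edge to contract. The empty set satisfies it vacuously, so nonemptiness of
  branch sets is recorded separately.\<close>

definition cut_connected :: "'a rel \<Rightarrow> 'a set \<Rightarrow> bool" where
  "cut_connected E S \<longleftrightarrow> (\<forall>A. A \<noteq> {} \<and> A \<subset> S \<longrightarrow> (\<exists>a\<in>A. \<exists>b\<in>S - A. (a, b) \<in> E))"

lemma connected_imp_cut_connected:
  assumes "sym (parcs G)" and "Digraph_Component.connected (with_proj G \<restriction> S)"
  shows "cut_connected (parcs G) S" "S \<noteq> {}"
proof -
  let ?H = "mk_symmetric (with_proj G \<restriction> S)"
  show "S \<noteq> {}" using assms(2) by (auto simp: connected_def strongly_connected_def)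
  have arcs: "(x, y) \<in> parcs G" if "(x, y) \<in> parcs ?H" for x y
    using that assms(1) by (auto simp: parcs_mk_symmetric dest: symD)
  show "cut_connected (parcs G) S"
    unfolding cut_connected_def
  proof (intro allI impI)
    fix A assume A: "A \<noteq> {} \<and> A \<subset> S"
    then obtain a b where ab: "a \<in> A" "b \<in> S - A" by blast
    then have "(a, b) \<in> rtrancl_on S (parcs ?H)"
      using A assms(2) by (auto simp: connected_def strongly_connected_def reachable_def)
    \<comment> \<open>The invariant along the walk: either it is still in \<open>A\<close>, or some
      arc leaving \<open>A\<close> has been met. At \<open>b\<close> only the second alternative is
      possible.\<close>
    then have "b \<in> A \<or> (\<exists>x\<in>A. \<exists>y\<in>S - A. (x, y) \<in> parcs ?H)"
    proof (induction rule: rtrancl_on_induct)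
      case base
      show ?case using ab by simp
    next
      case (step y z)
      then show ?case by blast
    qed
    then show "\<exists>a\<in>A. \<exists>b\<in>S - A. (a, b) \<in> parcs G" using ab arcs by blast
  qed
qed

section \<open>Edge contraction\<close>

text \<open>The merged vertex keeps the name \<open>u\<close>. The condition
  \<open>x \<noteq> y\<close> discards the loop left by \<open>uv\<close>, and parallel edges merge
  because arcs form a set.\<close>

definition contract :: "'a pair_pre_digraph \<Rightarrow> 'a \<Rightarrow> 'a \<Rightarrow> 'a pair_pre_digraph" where
  "contract G u v = \<lparr> pverts = pverts G - {v},
     parcs = {(x, y). x \<noteq> v \<and> y \<noteq> v \<and> x \<noteq> y \<and>
       ((x, y) \<in> parcs G \<or> x = u \<and> (v, y) \<in> parcs G \<or> y = u \<and> (x, v) \<in> parcs G)} \<rparr>"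

locale graph_edge = pair_graph G for G :: "'a pair_pre_digraph" +
  fixes u v :: 'a
  assumes edge: "(u, v) \<in> parcs G"
begin

lemma sym: "sym (parcs G)"
  using pair_sym_arcs by (simp add: symmetric_def)

lemma arc_commute: "(x, y) \<in> parcs G \<longleftrightarrow> (y, x) \<in> parcs G"
  using sym by (metis symD)

lemma no_loop: "(x, x) \<notin> parcs G"
  using pair_no_loops by fastforce

lemma neq: "u \<noteq> v"
  using edge no_loop by auto

lemma verts: "u \<in> pverts G" "v \<in> pverts G"
  using edge in_arcsD1 in_arcsD2 by blast+

lemma pverts_contract: "pverts (contract G u v) = pverts G - {v}"
  by (simp add: contract_def)

lemma in_parcs_contract:
  "(x, y) \<in> parcs (contract G u v) \<longleftrightarrow> x \<noteq> v \<and> y \<noteq> v \<and> x \<noteq> y \<and>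
     ((x, y) \<in> parcs G \<or> x = u \<and> (v, y) \<in> parcs G \<or> y = u \<and> (x, v) \<in> parcs G)"
  by (simp add: contract_def)

lemma pair_graph_contract: "pair_graph (contract G u v)"
proof -
  have wf: "x \<in> pverts G - {v}" "y \<in> pverts G - {v}" if "(x, y) \<in> parcs (contract G u v)" for x y
    using that verts in_arcsD1 in_arcsD2 unfolding in_parcs_contract by blast+
  then have "parcs (contract G u v) \<subseteq> pverts G \<times> pverts G" by auto
  then have "finite (parcs (contract G u v))"
    by (rule finite_subset) (simp add: pair_finite_verts)
  moreover have "sym (parcs (contract G u v))"
    by (rule symI) (use arc_commute in \<open>auto simp: in_parcs_contract\<close>)
  moreover have "(x, x) \<notin> parcs (contract G u v)" for x
    by (simp add: in_parcs_contract)
  ultimately show ?thesis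
    by unfold_locales (auto simp: pverts_contract pair_finite_verts symmetric_def dest: wf)
qed

section \<open>Lifting induced cycles\<close>

definition triangles :: "'a set set" where
  "triangles = (\<lambda>x. {u, v, x}) ` {x. (u, x) \<in> parcs G \<and> (v, x) \<in> parcs G}"

text \<open>The image of a vertex set under the contraction; it recovers a cycle from its lift.\<close>

definition push :: "'a set \<Rightarrow> 'a set" where
  "push T = (if v \<in> T then insert u (T - {v}) else T)"

text \<open>A cycle avoiding \<open>u\<close> is its own lift. Otherwise the rest of the cycle is an
  induced path of \<open>G\<close> whose ends are its only vertices adjacent to \<open>u\<close> or
  \<open>v\<close>. If one of \<open>u\<close>, \<open>v\<close> is adjacent to both ends, it closes
  the path; if not, each is adjacent to exactly one end and the edge \<open>uv\<close> closes
  it.\<close>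

lemma chordless_cycle_lift:
  assumes S: "S \<subseteq> pverts G - {v}" and cyc: "chordless_cycle (parcs (contract G u v)) S"
  shows "\<exists>T. T \<subseteq> pverts G \<and> chordless_cycle (parcs G) T \<and> T \<notin> triangles \<and> push T = S"
proof (cases "u \<in> S")
  case False
  have "chordless_cycle (parcs G) S"
    using cyc by (subst chordless_cycle_cong[where F = "parcs (contract G u v)"])
      (use S False no_loop in \<open>auto simp: in_parcs_contract\<close>)
  moreover have "S \<notin> triangles" "push S = S" using False S by (auto simp: triangles_def push_def)
  ultimately show ?thesis using S by blast
next
  case True
  then obtain ws where ws: "induced_path (parcs (contract G u v)) ws" "2 \<le> length ws"
      "u \<notin> set ws" "S = insert u (set ws)"
    and ends: "\<And>w. w \<in> set ws \<Longrightarrow> (u, w) \<in> parcs (contract G u v) \<longleftrightarrow> w = hd ws \<or> w = last ws"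
    using chordless_cycleE[OF cyc] by metis
  have v: "v \<notin> set ws" using S ws by auto
  have path: "induced_path (parcs G) ws"
    using ws(1) by (subst induced_path_cong[where F = "parcs (contract G u v)"])
      (use v ws no_loop in \<open>auto simp: in_parcs_contract\<close>)
  have uv: "(u, w) \<in> parcs G \<or> (v, w) \<in> parcs G \<longleftrightarrow> w = hd ws \<or> w = last ws" if "w \<in> set ws" for w
    using ends[OF that] that v ws(3) neq by (auto simp: in_parcs_contract)
  have ne: "ws \<noteq> []" using ws(2) by auto
  then have hdl: "hd ws \<in> set ws" "last ws \<in> set ws" by auto
  \<comment> \<open>This lift contains only one of \<open>u\<close> and \<open>v\<close>, hence is
    no triangle on \<open>uv\<close>.\<close>
  have single: "\<exists>T. T \<subseteq> pverts G \<and> chordless_cycle (parcs G) T \<and> T \<notin> triangles \<and> push T = S"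
    if a: "a = u \<or> a = v" and ah: "(a, hd ws) \<in> parcs G" "(a, last ws) \<in> parcs G" for a
  proof (intro exI conjI)
    show "insert a (set ws) \<subseteq> pverts G" using a ws S verts by auto
    show "chordless_cycle (parcs G) (insert a (set ws))"
      using a ah uv v ws(2,3) no_loop by (intro chordless_cycleI sym path) auto
    show "insert a (set ws) \<notin> triangles"
      using a neq v ws(3) by (auto simp: triangles_def)
    show "push (insert a (set ws)) = S"
      using a neq v ws by (auto simp: push_def)
  qed
  \<comment> \<open>The cycle runs through \<open>a\<close>, \<open>ws\<close>, \<open>b\<close> in
    this order. Stating it for \<open>{a, b} = {u, v}\<close> covers both ways of assigning the
    ends.\<close>
  have double: "\<exists>T. T \<subseteq> pverts G \<and> chordless_cycle (parcs G) T \<and> T \<notin> triangles \<and> push T = S"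
    if ab: "{a, b} = {u, v}" and ah: "(a, hd ws) \<in> parcs G" "(a, last ws) \<notin> parcs G"
      "(b, hd ws) \<notin> parcs G" "(b, last ws) \<in> parcs G" for a b
  proof (intro exI conjI)
    let ?T = "insert a (set (ws @ [b]))"
    have adj: "(a, b) \<in> parcs G" using ab edge arc_commute by (auto simp: doubleton_eq_iff)
    have nin: "a \<notin> set ws" "b \<notin> set ws" "a \<noteq> b" using ab neq v ws(3) by (auto simp: doubleton_eq_iff)
    have ab': "(a, w) \<in> parcs G \<or> (b, w) \<in> parcs G \<longleftrightarrow> w = hd ws \<or> w = last ws" if "w \<in> set ws" for w
      using uv[OF that] ab by (auto simp: doubleton_eq_iff)
    show "?T \<subseteq> pverts G" using ab ws S verts by (auto simp: doubleton_eq_iff)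
    have "induced_path (parcs G) (ws @ [b])"
      using ah ab' nin ne no_loop by (intro induced_path_snoc sym path) auto
    then show "chordless_cycle (parcs G) ?T"
      using ah ab' nin ne no_loop adj ws(2) by (intro chordless_cycleI sym) (auto simp: hd_append)
    have "?T = insert u (insert v (set ws))" using ab by auto
    moreover have "card (set ws) = length ws" using path by (simp add: induced_path_def distinct_card)
    ultimately have "card ?T = Suc (Suc (length ws))" using neq v ws(3) by simp
    \<comment> \<open>Size separates the lift from the triangles: \<open>ws\<close> has at least two
      vertices, so the lift has at least four.\<close>
    moreover have "card X \<le> 3" if "X \<in> triangles" for X
      using that by (auto simp: triangles_def card_insert_if)
    ultimately show "?T \<notin> triangles" using ws(2) by fastforce
    show "push ?T = S" using \<open>?T = insert u (insert v (set ws))\<close> neq v ws by (auto simp: push_def)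
  qed
  have "(u, hd ws) \<in> parcs G \<or> (v, hd ws) \<in> parcs G" "(u, last ws) \<in> parcs G \<or> (v, last ws) \<in> parcs G"
    using uv hdl by blast+
  then show ?thesis
    using single[OF disjI1[OF refl]] single[OF disjI2[OF refl]] double[OF refl] double[OF insert_commute]
    by argo
qed

lemma chordless_cycle_triangle:
  assumes "T \<in> triangles"
  shows "T \<subseteq> pverts G" "chordless_cycle (parcs G) T"
proof -
  obtain x where x: "(u, x) \<in> parcs G" "(v, x) \<in> parcs G" "T = {u, v, x}"
    using assms by (auto simp: triangles_def)
  then show "T \<subseteq> pverts G" using verts in_arcsD2[of u x] by simp
  have "x \<noteq> u" "x \<noteq> v" using x no_loop by auto
  moreover have "(x, v) \<in> parcs G" using x arc_commute by simp
  ultimately have "chordless_cycle (parcs G) (insert u (set [v, x]))"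
    using x edge neq by (intro chordless_cycleI sym)
      (auto simp: induced_path_def less_Suc_eq no_loop)
  then show "chordless_cycle (parcs G) T" using x by simp
qed

lemma finite_common: "finite {x. (u, x) \<in> parcs G \<and> (v, x) \<in> parcs G}"
  by (rule finite_subset[OF _ pair_finite_verts]) (auto dest: in_arcsD2)

lemma card_triangles: "card triangles = card {x. (u, x) \<in> parcs G \<and> (v, x) \<in> parcs G}"
  unfolding triangles_def
proof (rule card_image, rule inj_onI)
  fix x y assume "x \<in> {x. (u, x) \<in> parcs G \<and> (v, x) \<in> parcs G}"
    "y \<in> {x. (u, x) \<in> parcs G \<and> (v, x) \<in> parcs G}" "{u, v, x} = {u, v, y}"
  moreover from this have "x \<noteq> u" "x \<noteq> v" using no_loop by auto
  ultimately show "x = y" by blast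
qed

text \<open>By \<open>chordless_cycle_lift\<close>, \<open>push\<close> maps the induced cycles of
  \<open>G\<close> outside \<open>triangles\<close> onto a family containing every induced cycle of
  the contraction.\<close>

lemma card_induced_cycles_contract:
  "card (induced_cycles (contract G u v)) + card triangles \<le> card (induced_cycles G)"
proof -
  let ?C = "{S. S \<subseteq> pverts G \<and> chordless_cycle (parcs G) S}"
  let ?C' = "{S. S \<subseteq> pverts G - {v} \<and> chordless_cycle (parcs (contract G u v)) S}"
  have fin: "finite ?C" using pair_finite_verts by simp
  have sub: "triangles \<subseteq> ?C" using chordless_cycle_triangle by blast
  have "?C' \<subseteq> push ` (?C - triangles)" using chordless_cycle_lift by blast
  then have "card ?C' \<le> card (?C - triangles)"
    using fin by (meson card_image_le card_mono finite_Diff finite_imageI le_trans)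
  also have "\<dots> = card ?C - card triangles"
    using sub fin by (meson card_Diff_subset finite_subset)
  finally have "card ?C' + card triangles \<le> card ?C"
    using card_mono[OF fin sub] by linarith
  moreover have "pair_wf_digraph (contract G u v)"
    using pair_graph_contract by (simp add: pair_graph_def pair_digraph_def pair_fin_digraph_def)
  ultimately show ?thesis
    by (simp add: card_induced_cycles pair_wf_digraph_axioms pverts_contract)
qed

section \<open>Edges and connectivity under contraction\<close>

lemma card_edges_contract:
  "card (edges G) \<le> card (edges (contract G u v)) + card triangles + 1"
proof -
  let ?K = "{x. (u, x) \<in> parcs G \<and> (v, x) \<in> parcs G}"
  let ?D = "(\<lambda>x. {v, x}) ` ?K"
  let ?R = "edges G - insert {u, v} ?D"
  \<comment> \<open>\<open>push\<close> identifies the edges \<open>vx\<close> and \<open>ux\<close> for common neighbours \<open>x\<close> and collapses \<open>uv\<close>;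
    these are the only edges lost.\<close>
  have repr: "\<exists>x y. T = {x, y} \<and> x \<noteq> v \<and> x \<noteq> y \<and> (x, y) \<in> parcs G \<and>
      (y = v \<longrightarrow> x \<noteq> u \<and> (u, x) \<notin> parcs G)" if T: "T \<in> ?R" for T
  proof -
    obtain x y where xy: "T = {x, y}" "(x, y) \<in> parcs G" using T by (auto simp: edges_def)
    have "(y = v \<longrightarrow> x \<noteq> u \<and> (u, x) \<notin> parcs G)" "(x = v \<longrightarrow> y \<noteq> u \<and> (u, y) \<notin> parcs G)"
      using T xy arc_commute by (auto simp: insert_commute)
    moreover have "x \<noteq> y" "T = {y, x}" "(y, x) \<in> parcs G"
      using xy no_loop[of x] arc_commute[of y x] by auto
    ultimately show ?thesis using xy by (cases "x = v") blast+
  qed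
  have "push ` ?R \<subseteq> edges (contract G u v)"
  proof (rule image_subsetI)
    fix T assume "T \<in> ?R"
    obtain x y where xy: "T = {x, y}" "x \<noteq> v" "x \<noteq> y" "(x, y) \<in> parcs G"
        "y = v \<longrightarrow> x \<noteq> u \<and> (u, x) \<notin> parcs G"
      using repr[OF \<open>T \<in> ?R\<close>] by blast
    show "push T \<in> edges (contract G u v)"
    proof (cases "y = v")
      case True
      then have "push T = {x, u}" using xy by (auto simp: push_def)
      moreover have "(x, u) \<in> parcs (contract G u v)"
        using xy True neq by (auto simp: in_parcs_contract)
      ultimately show ?thesis unfolding edges_def by blast
    next
      case False
      then have "push T = {x, y}" using xy by (auto simp: push_def)
      moreover have "(x, y) \<in> parcs (contract G u v)"
        using xy False by (auto simp: in_parcs_contract)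
      ultimately show ?thesis unfolding edges_def by blast
    qed
  qed
  \<comment> \<open>A remaining edge \<open>xv\<close> is sent to \<open>{u, x}\<close>, which is
    not an edge of \<open>G\<close>; so it cannot meet the image of an edge avoiding
    \<open>v\<close>.\<close>
  moreover have "inj_on push ?R"
  proof (rule inj_onI)
    fix S T assume "S \<in> ?R" "T \<in> ?R" and eq: "push S = push T"
    obtain x y where xy: "S = {x, y}" "x \<noteq> v" "x \<noteq> y" "(x, y) \<in> parcs G"
        "y = v \<longrightarrow> x \<noteq> u \<and> (u, x) \<notin> parcs G"
      using repr[OF \<open>S \<in> ?R\<close>] by blast
    obtain z w where zw: "T = {z, w}" "z \<noteq> v" "z \<noteq> w" "(z, w) \<in> parcs G"
        "w = v \<longrightarrow> z \<noteq> u \<and> (u, z) \<notin> parcs G"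
      using repr[OF \<open>T \<in> ?R\<close>] by blast
    have "push S = (if y = v then {u, x} else {x, y})" using xy by (auto simp: push_def)
    moreover have "push T = (if w = v then {u, z} else {z, w})" using zw by (auto simp: push_def)
    ultimately show "S = T"
      using eq xy zw arc_commute by (auto simp: doubleton_eq_iff split: if_splits)
  qed
  moreover have "finite (edges H)" if "pair_graph H" for H :: "'a pair_pre_digraph"
  proof -
    interpret H: pair_graph H by fact
    have "edges H \<subseteq> Pow (pverts H)"
      by (auto simp: edges_def dest: H.in_arcsD1 H.in_arcsD2)
    then show ?thesis by (rule finite_subset) (simp add: H.pair_finite_verts)
  qed
  ultimately have "card ?R \<le> card (edges (contract G u v))"
    using pair_graph_contract by (meson card_inj_on_le)
  moreover have "card (edges G) \<le> card ?R + card (insert {u, v} ?D)"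
    using diff_card_le_card_Diff[of "insert {u, v} ?D" "edges G"] finite_common by simp
  moreover have "card (insert {u, v} ?D) \<le> card triangles + 1"
    using card_insert_le_m1[of "card triangles + 1" ?D "{u, v}"] card_image_le[OF finite_common, of "\<lambda>x. {v, x}"]
      card_triangles by simp
  ultimately show ?thesis by linarith
qed

text \<open>The losses balance: at least \<open>card triangles\<close> cycles and exactly one
  vertex, against at most \<open>card triangles + 1\<close> edges.\<close>

lemma beth2_contract: "beth2 (contract G u v) \<le> beth2 G"
proof -
  have "card (pverts G) = card (pverts (contract G u v)) + 1"
    using verts pair_finite_verts by (metis Suc_eq_plus1 card_Suc_Diff1 pverts_contract)
  then show ?thesis
    using card_edges_contract card_induced_cycles_contract unfolding beth2_def by linarith
qed

text \<open>A cut of the contracted set pulls back to a cut of \<open>S\<close> with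
  \<open>v\<close> on the side of \<open>u\<close>. An arc across it is therefore not
  \<open>uv\<close> and survives after renaming \<open>v\<close> to \<open>u\<close>;
  \<open>uS\<close> keeps the renamed end inside the set.\<close>

lemma cut_connected_contract:
  assumes "cut_connected (parcs G) S" and uS: "v \<in> S \<Longrightarrow> u \<in> S"
  shows "cut_connected (parcs (contract G u v)) (S - {v})"
  unfolding cut_connected_def
proof (intro allI impI)
  fix A assume A: "A \<noteq> {} \<and> A \<subset> S - {v}"
  define A' where "A' = (if u \<in> A \<and> v \<in> S then insert v A else A)"
  have "A' \<noteq> {} \<and> A' \<subset> S" using A unfolding A'_def by auto
  then obtain a b where ab: "a \<in> A'" "b \<in> S - A'" "(a, b) \<in> parcs G"
    using assms(1) unfolding cut_connected_def by meson
  define a' b' where "a' = (if a = v then u else a)" and "b' = (if b = v then u else b)"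
  have "a' \<in> A" "b' \<in> S - {v} - A"
    using ab A uS neq unfolding a'_def b'_def A'_def by (auto split: if_splits)
  moreover have "(a', b') \<in> parcs (contract G u v)"
    using ab calculation A no_loop neq unfolding a'_def b'_def A'_def
    by (auto simp: in_parcs_contract split: if_splits)
  ultimately show "\<exists>a\<in>A. \<exists>b\<in>S - {v} - A. (a, b) \<in> parcs (contract G u v)" by blast
qed

end

section \<open>Contracting a model to a complete graph\<close>

text \<open>Induction on the number of vertices: all hypotheses survive a contraction when
  \<open>v\<close> is deleted from the branch sets. Once no suitable edge is left, the branch sets
  are singletons covering \<open>G\<close>, so \<open>G\<close> is complete on \<open>t\<close>
  vertices.\<close>

lemma beth2_ge_of_branch_sets:
  fixes G :: "'a pair_pre_digraph" and B :: "nat \<Rightarrow> 'a set"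
  assumes "pair_graph G" "cut_connected (parcs G) (pverts G)" "0 < t"
    and "\<And>i. i < t \<Longrightarrow> B i \<noteq> {} \<and> B i \<subseteq> pverts G \<and> cut_connected (parcs G) (B i)"
    and "\<And>i j. i < t \<Longrightarrow> j < t \<Longrightarrow> i \<noteq> j \<Longrightarrow> B i \<inter> B j = {}"
    and "\<And>i j. i < t \<Longrightarrow> j < t \<Longrightarrow> i \<noteq> j \<Longrightarrow> \<exists>x\<in>B i. \<exists>y\<in>B j. (x, y) \<in> parcs G"
  shows "int (t choose 3) - int (t choose 2) + int t \<le> beth2 G"
  using assms(1,2,4-6)
proof (induction "card (pverts G)" arbitrary: G B rule: less_induct)
  case less
  interpret pair_graph G by fact
  note branch = less.prems(3) and disj = less.prems(4) and touch = less.prems(5)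
  let ?U = "\<Union>i<t. B i"
  have U: "?U \<subseteq> pverts G" using branch by blast
  show ?case
    \<comment> \<open>Contract an edge inside a branch set or from a branch set to an uncovered vertex.\<close>
  proof (cases "\<exists>i<t. \<exists>u\<in>B i. \<exists>v. (u, v) \<in> parcs G \<and> (v \<in> B i \<or> v \<notin> ?U)")
    case True
    then obtain i u v where i: "i < t" and uv: "u \<in> B i" "(u, v) \<in> parcs G" "v \<in> B i \<or> v \<notin> ?U"
      by blast
    interpret graph_edge G u v by unfold_locales fact
    \<comment> \<open>By disjointness \<open>B i\<close> is the only branch set that can contain
      \<open>v\<close>, so replacing \<open>v\<close> by \<open>u\<close> never leaves a branch
      set.\<close>
    have uB: "u \<in> B j" if "j < t" "v \<in> B j" for j
      using that uv i disj[of i j] by (cases "i = j") auto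
    have "int (t choose 3) - int (t choose 2) + int t \<le> beth2 (contract G u v)"
    proof (rule less.hyps[where B = "\<lambda>j. B j - {v}"])
      show "card (pverts (contract G u v)) < card (pverts G)"
        using verts pair_finite_verts card_Diff1_less[of "pverts G" v] by (simp only: pverts_contract)
      show "pair_graph (contract G u v)" by (rule pair_graph_contract)
      show "cut_connected (parcs (contract G u v)) (pverts (contract G u v))"
        using less.prems(2) verts by (simp add: pverts_contract cut_connected_contract)
      show "B j - {v} \<noteq> {} \<and> B j - {v} \<subseteq> pverts (contract G u v) \<and>
          cut_connected (parcs (contract G u v)) (B j - {v})" if "j < t" for j
        using branch[OF that] uB[OF that] neq
        by (auto simp: pverts_contract intro!: cut_connected_contract)
      show "(B j - {v}) \<inter> (B k - {v}) = {}" if "j < t" "k < t" "j \<noteq> k" for j k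
        using disj[OF that] by auto
      show "\<exists>x\<in>B j - {v}. \<exists>y\<in>B k - {v}. (x, y) \<in> parcs (contract G u v)"
        if jk: "j < t" "k < t" "j \<noteq> k" for j k
      proof -
        obtain x y where xy: "x \<in> B j" "y \<in> B k" "(x, y) \<in> parcs G" using touch[OF jk] by blast
        define x' y' where "x' = (if x = v then u else x)" and "y' = (if y = v then u else y)"
        have "x' \<in> B j - {v}" "y' \<in> B k - {v}"
          using xy uB jk neq unfolding x'_def y'_def by auto
        \<comment> \<open>The renamed ends lie in disjoint branch sets, so the arc does not collapse
          to a loop.\<close>
        moreover have "(x', y') \<in> parcs (contract G u v)"
          using xy calculation disj[OF jk] unfolding x'_def y'_def
          by (auto simp: in_parcs_contract split: if_splits)
        ultimately show ?thesis by blast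
      qed
    qed
    then show ?thesis using beth2_contract by linarith
  next
    case False
    have single: "\<exists>x. B i = {x}" if i: "i < t" for i
    proof -
      obtain x where x: "x \<in> B i" using branch[OF i] by auto
      have "B i = {x}"
      proof (rule ccontr)
        assume "B i \<noteq> {x}"
        \<comment> \<open>A second vertex in \<open>B i\<close> makes \<open>{x}\<close> a proper
          cut, whose crossing arc could still be contracted.\<close>
        then have "{x} \<noteq> {} \<and> {x} \<subset> B i" using x by auto
        then have "\<exists>b\<in>B i. (x, b) \<in> parcs G"
          using branch[OF i] unfolding cut_connected_def by blast
        then show False using False i x by blast
      qed
      then show ?thesis by blast
    qed
    have cover: "?U = pverts G"
    proof (rule ccontr)
      assume "?U \<noteq> pverts G"
      \<comment> \<open>Here \<open>0 < t\<close> enters: the covered part must be nonempty to be a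
        cut with an arc to an uncovered vertex.\<close>
      moreover have "?U \<noteq> {}" using branch assms(3) by auto
      ultimately have "?U \<noteq> {} \<and> ?U \<subset> pverts G" using U by blast
      then have "\<exists>a\<in>?U. \<exists>b\<in>pverts G - ?U. (a, b) \<in> parcs G"
        by (rule less.prems(2)[unfolded cut_connected_def, rule_format])
      then show False using False by blast
    qed
    obtain f where f: "\<And>i. i < t \<Longrightarrow> B i = {f i}" using single by metis
    have "pverts G = f ` {..<t}" using cover f by auto
    moreover have "inj_on f {..<t}"
      using disj f by (auto intro!: inj_onI)
    ultimately have "card (pverts G) = t" by (simp add: card_image)
    moreover have "(x, y) \<in> parcs G" if xy: "x \<in> pverts G" "y \<in> pverts G" "x \<noteq> y" for x y
    proof -
      obtain i j where "i < t" "j < t" "x = f i" "y = f j"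
        using \<open>pverts G = f ` {..<t}\<close> xy by auto
      then show ?thesis using touch[of i j] f xy by auto
    qed
    ultimately show ?thesis using beth2_complete[OF less.prems(1)] by auto
  qed
qed

lemma beth2_complete_graph:
  "beth2 (complete_graph t) = int (t choose 3) - int (t choose 2) + int t"
proof -
  have "parcs (complete_graph t) \<subseteq> {..<t} \<times> {..<t}" by (auto simp: complete_graph_def)
  then have "finite (parcs (complete_graph t))" by (rule finite_subset) simp
  then have "pair_graph (complete_graph t)"
    by unfold_locales (auto simp: complete_graph_def symmetric_def intro: symI)
  then show ?thesis by (subst beth2_complete) (auto simp: complete_graph_def)
qed

theorem corollary3p1p1:
  fixes G :: "'a pair_pre_digraph"
  assumes "pair_graph G"
    and "Digraph_Component.connected (with_proj G)"
  shows "beth2 (complete_graph (hadwiger G)) \<le> beth2 G \<and>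
    int (hadwiger G choose 3) - int (hadwiger G choose 2) + int (hadwiger G choose 1) \<le> beth2 G"
proof -
  interpret pair_graph G by fact
  let ?h = "hadwiger G"
  have sym: "sym (parcs G)" using pair_sym_arcs by (simp add: symmetric_def)
  have whole: "with_proj G \<restriction> pverts G = with_proj G"
    unfolding induce_subgraph_def with_proj_def by (auto dest: in_arcsD1 in_arcsD2)
  have con: "cut_connected (parcs G) (pverts G)"
    using connected_imp_cut_connected(1)[of G "pverts G"] sym assms(2) whole by simp
  \<comment> \<open>The whole connected graph serves as a single branch set; this gives the
    positivity required by the induction.\<close>
  have "is_minor (complete_graph 1) G"
    unfolding is_minor_def using assms(2) whole
    by (intro exI[of _ "\<lambda>_. pverts G"]) (auto simp: complete_graph_def)
  then have pos: "0 < ?h"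
    using Max_ge[OF finite_complete_minors[OF assms(1)], of 1] unfolding hadwiger_def by simp
  obtain B :: "nat \<Rightarrow> 'a set" where
    B: "\<forall>i\<in>{..<?h}. B i \<subseteq> pverts G \<and> Digraph_Component.connected (with_proj G \<restriction> B i)"
    and disj: "\<forall>i\<in>{..<?h}. \<forall>j\<in>{..<?h}. i \<noteq> j \<longrightarrow> B i \<inter> B j = {}"
    and touch: "\<forall>i j. i < ?h \<and> j < ?h \<and> i \<noteq> j \<longrightarrow> (\<exists>x\<in>B i. \<exists>y\<in>B j. (x, y) \<in> parcs G)"
    using is_minor_complete_hadwiger[OF assms(1)]
    unfolding is_minor_def complete_graph_def by auto
  have "int (?h choose 3) - int (?h choose 2) + int ?h \<le> beth2 G"
    by (rule beth2_ge_of_branch_sets[OF assms(1) con pos, of B])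
      (use B disj touch connected_imp_cut_connected[OF sym] in auto)
  then show ?thesis by (simp add: beth2_complete_graph)
qed

end
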